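(* Let $k$ be a field and $V=k((t))((u))$. Let $W\subset V$ be a $k$-subspace such that for every integer $n$ the space $W(n)$ is a Fredholm subspace of the one-dimensional local field $k((t))$, and there are numbers $a,b$ with $b<0$ such that $\chi(W(n))=a+bn$ for all $n\in\mathbb{Z}$. Let $A\subset V$ be a subring with $k\subset A$ and $A\cdot W\subset W$. Then: (a) for every nonzero element $x\in A$ one has $\bar\nu(x)\le b\,\nu(x)$; (b) $\operatorname{trdeg}_k \operatorname{Frac}(A\cap\mathcal{O}_2)\le 2$, and the field $\operatorname{Frac}(A\cap \mathcal{O}_2)$ is finitely generated over $k$.
   Context: $V=k((t))((u))$ is the field of Laurent series in $u$ with coefficients in $k((t))$. Put $\mathcal{O}_1=k((t))[[u]]$ and $\mathcal{O}_2=k[[t]]((u))$ (Laurent series in $u$ with coefficients in $k[[t]]$), both regarded as subsets of $V$. For a nonzero $x=\sum_{i\ge m}x_iu^i\in V$ with $x_i\in k((t))$ and $x_m\neq0$, put $\nu(x)=m$ and $\bar\nu(x)=\operatorname{ord}_t(x_m)$, the $t$-adic valuation of the leading coefficient. For a $k$-subspace $W\subset V$ and $n\in\mathbb{Z}$ put $W(n)=(u^n\mathcal{O}_1\cap W)/(u^{n+1}\mathcal{O}_1\cap W)$. It is regarded as a $k$-subspace of $u^n\mathcal{O}_1/u^{n+1}\mathcal{O}_1\cong k((t))$ (identification by taking the coefficient of $u^n$). A $k$-subspace $U\subset k((t))$ is Fredholm if $\dim_k (U\cap k[[t]])<\infty$ and $\dim_k k((t))/(U+k[[t]])<\infty$.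 In that case its Euler characteristic is $\chi(U)=\dim_k (U\cap k[[t]])-\dim_k k((t))/(U+k[[t]])$. $\operatorname{Frac}$ denotes the field of fractions of an integral domain. $\operatorname{trdeg}_k$ is the maximal number of elements algebraically independent over $k$. *)

theory Defs
  imports
    Complex_Main
    "HOL-Computational_Algebra.Formal_Laurent_Series"
    "HOL-Library.Set_Algebras"
    "HOL-Library.Poly_Mapping"
    "HOL-Library.Extended_Nat"
begin

section \<open>Dimension of subspaces and of quotients\<close>

definition fin_dim :: "('k::field \<Rightarrow> 'v::ab_group_add \<Rightarrow> 'v) \<Rightarrow> 'v set \<Rightarrow> bool" where
  "fin_dim scale U \<longleftrightarrow>
     (\<exists>B. finite B \<and> \<not> module.dependent scale B \<and> module.span scale B = U)"

text \<open>
  The ambient vector space is a type, so the quotient by a subspace \<open>S\<close> is handled through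
  representatives: the classes of the elements of the finite set \<open>B\<close> span the quotient and are
  linearly independent in it. (Independence forces distinct elements of \<open>B\<close> to have distinct
  classes, so \<open>card B\<close> is the number of classes.)
\<close>

definition finite_quotient_basis ::
  "('k::field \<Rightarrow> 'v::ab_group_add \<Rightarrow> 'v) \<Rightarrow> 'v set \<Rightarrow> 'v set \<Rightarrow> bool" where
  "finite_quotient_basis scale S B \<longleftrightarrow> finite B \<and>
     (\<forall>v. \<exists>c. v - (\<Sum>b\<in>B. scale (c b) b) \<in> S) \<and>
     (\<forall>c. (\<Sum>b\<in>B. scale (c b) b) \<in> S \<longrightarrow> (\<forall>b\<in>B. c b = 0))"

definition fin_codim :: "('k::field \<Rightarrow> 'v::ab_group_add \<Rightarrow> 'v) \<Rightarrow> 'v set \<Rightarrow> bool" where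
  "fin_codim scale S \<longleftrightarrow> (\<exists>B. finite_quotient_basis scale S B)"

text \<open>As for \<^const>\<open>vector_space.dim\<close>, the value is meaningful only in the finite case.\<close>

definition codim :: "('k::field \<Rightarrow> 'v::ab_group_add \<Rightarrow> 'v) \<Rightarrow> 'v set \<Rightarrow> nat" where
  "codim scale S = card (SOME B. finite_quotient_basis scale S B)"


section \<open>Transcendence degree and finitely generated field extensions\<close>

text \<open>
  Base rings are given by an embedding \<open>\<iota>\<close> into the ambient ring. A polynomial in variables
  indexed by \<open>'i\<close> is a finitely supported map from exponent vectors to coefficients.
\<close>

definition mpoly_eval ::
  "('k::zero \<Rightarrow> 'v::comm_ring_1) \<Rightarrow> ('i \<Rightarrow> 'v) \<Rightarrow> (('i \<Rightarrow>\<^sub>0 nat) \<Rightarrow>\<^sub>0 'k) \<Rightarrow> 'v" where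
  "mpoly_eval \<iota> x p =
     (\<Sum>m\<in>Poly_Mapping.keys p. \<iota> (Poly_Mapping.lookup p m) *
        (\<Prod>i\<in>Poly_Mapping.keys m. x i ^ Poly_Mapping.lookup m i))"

text \<open>The elements of \<open>S\<close> serve as their own variable names.\<close>

definition algebraically_independent ::
  "('k::zero \<Rightarrow> 'v::comm_ring_1) \<Rightarrow> 'v set \<Rightarrow> bool" where
  "algebraically_independent \<iota> S \<longleftrightarrow>
     (\<forall>p. (\<forall>m\<in>Poly_Mapping.keys p. Poly_Mapping.keys m \<subseteq> S) \<longrightarrow>
          mpoly_eval \<iota> (\<lambda>s. s) p = 0 \<longrightarrow> p = 0)"

definition trdeg :: "('k::zero \<Rightarrow> 'v::comm_ring_1) \<Rightarrow> 'v set \<Rightarrow> enat" where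
  "trdeg \<iota> K = (SUP S\<in>{S. S \<subseteq> K \<and> finite S \<and> algebraically_independent \<iota> S}. enat (card S))"

definition is_subring :: "'v::ring_1 set \<Rightarrow> bool" where
  "is_subring R \<longleftrightarrow> 0 \<in> R \<and> 1 \<in> R \<and> (\<forall>x\<in>R. - x \<in> R) \<and>
     (\<forall>x\<in>R. \<forall>y\<in>R. x + y \<in> R \<and> x * y \<in> R)"

definition is_subfield :: "'v::field set \<Rightarrow> bool" where
  "is_subfield F \<longleftrightarrow> is_subring F \<and> (\<forall>x\<in>F. inverse x \<in> F)"

text \<open>The field of fractions of a subring of a field, realised inside that field.\<close>

definition Frac :: "'v::field set \<Rightarrow> 'v set" where
  "Frac R = {x / y | x y. x \<in> R \<and> y \<in> R \<and> y \<noteq> 0}"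

definition finitely_generated_field :: "('k \<Rightarrow> 'v::field) \<Rightarrow> 'v set \<Rightarrow> bool" where
  "finitely_generated_field \<iota> K \<longleftrightarrow> (\<exists>S. finite S \<and> K = is_subfield hull (range \<iota> \<union> S))"


section \<open>The fields \<open>k((t))\<close> and \<open>k((t))((u))\<close>\<close>

abbreviation kt_scale :: "'k::field \<Rightarrow> 'k fls \<Rightarrow> 'k fls" where
  "kt_scale c f \<equiv> fls_const c * f"

global_interpretation kt: vector_space kt_scale
  by unfold_locales (simp_all add: algebra_simps flip: fls_plus_const)

definition const2 :: "'k::field \<Rightarrow> 'k fls fls" where
  "const2 c = fls_const (fls_const c)"

abbreviation V_scale :: "'k::field \<Rightarrow> 'k fls fls \<Rightarrow> 'k fls fls" where
  "V_scale c x \<equiv> const2 c * x"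

global_interpretation V: vector_space V_scale
  by unfold_locales (simp_all add: const2_def algebra_simps flip: fls_plus_const)

definition power_series :: "'k::field fls set" where
  "power_series = range fps_to_fls"

definition O1 :: "'k::field fls fls set" where
  "O1 = range fps_to_fls"

definition O2 :: "'k::field fls fls set" where
  "O2 = {x. \<forall>i. fls_nth x i \<in> power_series}"

text \<open>Both valuations are meaningful only for nonzero arguments.\<close>

definition \<nu> :: "'k::field fls fls \<Rightarrow> int" where
  "\<nu> x = fls_subdegree x"

definition \<nu>_bar :: "'k::field fls fls \<Rightarrow> int" where
  "\<nu>_bar x = fls_subdegree (fls_nth x (\<nu> x))"

text \<open>
  The kernel of the \<open>n\<close>-th coefficient map on \<open>u\<^sup>n O1 \<inter> W\<close> is \<open>u\<^sup>n\<^sup>+\<^sup>1 O1 \<inter> W\<close>; the quotient is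
  identified with the image of that map.
\<close>

definition graded_piece :: "'k::field fls fls set \<Rightarrow> int \<Rightarrow> 'k fls set" where
  "graded_piece W n = (\<lambda>x. fls_nth x n) ` ((fls_X_intpow n *o O1) \<inter> W)"

definition fredholm :: "'k::field fls set \<Rightarrow> bool" where
  "fredholm U \<longleftrightarrow> kt.subspace U \<and> fin_dim kt_scale (U \<inter> power_series) \<and> fin_codim kt_scale (U + power_series)"

definition euler_char :: "'k::field fls set \<Rightarrow> int" where
  "euler_char U = int (kt.dim (U \<inter> power_series)) - int (codim kt_scale (U + power_series))"

end

theory Submission
  imports Defs
begin

text \<open>
  The Euler characteristic of a Fredholm subspace \<open>U \<subseteq> k((t))\<close> depends only on the set of orders
  of its elements: it is the number of orders in \<open>[-M, K)\<close> minus \<open>M\<close>, for all large \<open>M\<close> and \<open>K\<close>.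
  Hence it is monotone in \<open>U\<close>, and multiplication by \<open>c\<close> raises it by the order of \<open>c\<close>. For
  \<open>x \<in> A\<close> the leading coefficient of \<open>x\<close> maps \<open>W(n)\<close> into \<open>W(n + \<nu> x)\<close>, which gives (a).

  Let \<open>R = A \<inter> O2\<close>. By (a) the values \<open>(\<nu>, \<nu>_bar)\<close> of \<open>R\<close> lie in a cone
  \<open>0 \<le> \<nu>_bar \<le> - D \<nu>\<close>, and a space of Laurent series has dimension at most its number of values.
  So the elements of \<open>R\<close> with pole order at most \<open>n\<close> form a space of dimension \<open>O(n^2)\<close>, which
  leaves no room for the monomials in three algebraically independent elements. For finite
  generation take elements \<open>Y\<close> of \<open>R\<close> whose values form a basis of the rational span of all values;
  the monomials in \<open>Y\<close> already grow like a multiple of the dimension bound, so \<open>R\<close> has bounded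
  rank over \<open>k(Y)\<close>.
\<close>

section \<open>Linear algebra: counting vectors that are independent modulo a subspace\<close>

text \<open>Gaussian elimination by induction on the set of equations: a pivot \<open>a p j\<close>
  removes the equation \<open>j\<close> together with the unknown \<open>p\<close>, so the strict
  inequality between the cardinalities survives.\<close>

lemma homogeneous_system_nontrivial_solution:
  fixes a :: "'i \<Rightarrow> 'j \<Rightarrow> 'k::field"
  assumes "finite J" "finite I" "card J < card I"
  shows "\<exists>c. (\<exists>i\<in>I. c i \<noteq> 0) \<and> (\<forall>j\<in>J. (\<Sum>i\<in>I. c i * a i j) = 0)"
  using assms
proof (induction J arbitrary: I a rule: finite_induct)
  case empty
  then have "I \<noteq> {}" by auto
  then show ?case by (intro exI[of _ "\<lambda>_. 1"]) auto
next
  case (insert j J)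
  show ?case
  proof (cases "\<forall>i\<in>I. a i j = 0")
    case True
    obtain c where "\<exists>i\<in>I. c i \<noteq> 0" "\<forall>j\<in>J. (\<Sum>i\<in>I. c i * a i j) = 0"
      using insert.IH[of I a] insert.prems insert.hyps by auto
    then show ?thesis using True by (intro exI[of _ c]) auto
  next
    case False
    then obtain p where p: "p \<in> I" "a p j \<noteq> 0" by blast
    define I' where "I' = I - {p}"
    have I: "I = insert p I'" "p \<notin> I'" "finite I'" using p insert.prems by (auto simp: I'_def)
    have "card J < card I'" using insert.prems insert.hyps I by simp
    then obtain c where c: "\<exists>i\<in>I'. c i \<noteq> 0"
      "\<And>l. l \<in> J \<Longrightarrow> (\<Sum>i\<in>I'. c i * (a i l - a i j / a p j * a p l)) = 0"
      using insert.IH[OF I(3), of "\<lambda>i l. a i l - a i j / a p j * a p l"] by auto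
    \<comment> \<open>The value at \<open>p\<close> is the one that solves equation
      \<open>j\<close>. The reduced equations differ from the original ones by multiples of equation
      \<open>j\<close>, so the original ones then hold too.\<close>
    define d where "d = c(p := - (\<Sum>i\<in>I'. c i * a i j) / a p j)"
    have sum_d: "(\<Sum>i\<in>I. d i * a i l) = d p * a p l + (\<Sum>i\<in>I'. c i * a i l)" for l
      using I by (auto simp: d_def intro!: sum.cong)
    have "(\<Sum>i\<in>I. d i * a i l) = 0" if "l \<in> insert j J" for l
    proof (cases "l = j")
      case True
      then show ?thesis using p sum_d by (simp add: d_def)
    next
      case False
      then have "0 = (\<Sum>i\<in>I'. c i * (a i l - a i j / a p j * a p l))" using c(2) that by simp
      also have "\<dots> = (\<Sum>i\<in>I'. c i * a i l) - (\<Sum>i\<in>I'. c i * a i j) / a p j * a p l"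
        by (simp add: right_diff_distrib sum_subtractf sum_distrib_right sum_divide_distrib mult.assoc)
      finally show ?thesis using sum_d[of l] by (simp add: d_def[THEN fun_cong, of p])
    qed
    moreover have "\<exists>i\<in>I. d i \<noteq> 0" using c(1) I by (auto simp: d_def)
    ultimately show ?thesis by blast
  qed
qed

text \<open>The exchange bound in a quotient: with more \<open>e i\<close> than \<open>f j\<close>,
  some nontrivial combination of the \<open>e i\<close> has all its \<open>f\<close>-coefficients
  zero and therefore falls into \<open>S\<close>. Taking \<open>S = {0}\<close> compares dimensions,
  taking \<open>S = U + power_series\<close> compares codimensions.\<close>

lemma (in vector_space) card_independent_mod_le:
  assumes S: "subspace S" and fin: "finite I" "finite J"
    and spans: "\<And>i. i \<in> I \<Longrightarrow> \<exists>c. e i - (\<Sum>j\<in>J. c j *s f j) \<in> S"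
    and indep: "\<And>c. (\<Sum>i\<in>I. c i *s e i) \<in> S \<Longrightarrow> \<forall>i\<in>I. c i = 0"
  shows "card I \<le> card J"
proof (rule ccontr)
  assume "\<not> card I \<le> card J"
  moreover obtain a where a: "\<And>i. i \<in> I \<Longrightarrow> e i - (\<Sum>j\<in>J. a i j *s f j) \<in> S"
    using spans by metis
  ultimately obtain c where c: "\<exists>i\<in>I. c i \<noteq> 0" "\<forall>j\<in>J. (\<Sum>i\<in>I. c i * a i j) = 0"
    using homogeneous_system_nontrivial_solution[OF fin(2,1), of a] by auto
  have "(\<Sum>i\<in>I. c i *s (\<Sum>j\<in>J. a i j *s f j)) = (\<Sum>i\<in>I. \<Sum>j\<in>J. (c i * a i j) *s f j)"
    by (simp add: scale_sum_right)
  also have "\<dots> = (\<Sum>j\<in>J. (\<Sum>i\<in>I. c i * a i j) *s f j)"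
    by (subst sum.swap) (simp add: scale_sum_left)
  also have "\<dots> = 0" using c(2) by simp
  finally have "(\<Sum>i\<in>I. c i *s e i) = (\<Sum>i\<in>I. c i *s (e i - (\<Sum>j\<in>J. a i j *s f j)))"
    by (simp add: scale_right_diff_distrib sum_subtractf)
  also have "\<dots> \<in> S" using a S by (intro subspace_sum subspace_scale) auto
  finally show False using indep c(1) by blast
qed

section \<open>The Euler characteristic in terms of orders\<close>

text \<open>The zero series is removed because its \<open>fls_subdegree\<close> is only a default
  value.\<close>

definition ords :: "'k::field fls set \<Rightarrow> int set" where
  "ords U = fls_subdegree ` (U - {0})"

lemma power_series_iff: "x \<in> power_series \<longleftrightarrow> (\<forall>i<0. fls_nth x i = 0)"
proof
  assume "\<forall>i<0. fls_nth x i = 0"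
  then have "fls_subdegree x \<ge> 0" by (intro fls_subdegree_ge0I) auto
  then show "x \<in> power_series"
    unfolding power_series_def by (metis fls_regpart_to_fls_trivial rangeI)
qed (auto simp: power_series_def)

lemma subspace_power_series: "kt.subspace power_series"
  by (auto simp: kt.subspace_def power_series_iff)

lemma subspace_plus: "kt.subspace U \<Longrightarrow> kt.subspace T \<Longrightarrow> kt.subspace (U + T)"
proof -
  have "U + T = {x + y |x y. x \<in> U \<and> y \<in> T}" by (auto simp: set_plus_def)
  then show "kt.subspace U \<Longrightarrow> kt.subspace T \<Longrightarrow> kt.subspace (U + T)"
    using kt.subspace_sums[of U T] by simp
qed

text \<open>Since the orders are distinct, nothing cancels the term of least order among those with
  nonzero coefficient. The conclusion is phrased by coefficients so that it can be transferred to
  another series agreeing with the sum up to that order.\<close>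

lemma subdegree_sum_least:
  fixes c :: "'i \<Rightarrow> 'k::field"
  assumes "finite I" "inj_on (\<lambda>i. fls_subdegree (h i)) I"
    and "\<And>i. i \<in> I \<Longrightarrow> h i \<noteq> 0" "\<exists>i\<in>I. c i \<noteq> 0"
  shows "\<exists>p\<in>I. (\<forall>l<fls_subdegree (h p). fls_nth (\<Sum>i\<in>I. kt_scale (c i) (h i)) l = 0) \<and>
    fls_nth (\<Sum>i\<in>I. kt_scale (c i) (h i)) (fls_subdegree (h p)) \<noteq> 0"
proof -
  define I' where "I' = {i\<in>I. c i \<noteq> 0}"
  have I': "finite I'" "I' \<noteq> {}" "I' \<subseteq> I" using assms(1,4) by (auto simp: I'_def)
  define p where "p = arg_min_on (\<lambda>i. fls_subdegree (h i)) I'"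
  have p: "p \<in> I'" "\<And>i. i \<in> I' \<Longrightarrow> fls_subdegree (h p) \<le> fls_subdegree (h i)"
    using arg_min_if_finite(1)[OF I'(1,2), of "\<lambda>i. fls_subdegree (h i)"]
      arg_min_least[OF I'(1,2), of _ "\<lambda>i. fls_subdegree (h i)"] by (auto simp: p_def)
  have lt: "fls_subdegree (h p) < fls_subdegree (h i)" if "i \<in> I'" "i \<noteq> p" for i
    using p that I'(3) inj_onD[OF assms(2), of i p] by (metis order_le_less subsetD)
  have nth: "fls_nth (\<Sum>i\<in>I. kt_scale (c i) (h i)) l = (\<Sum>i\<in>I'. c i * fls_nth (h i) l)" for l
    unfolding fls_nth_sum fls_mult_const_nth I'_def using assms(1)
    by (intro sum.mono_neutral_right) auto
  have cp: "p \<in> I" "c p \<noteq> 0" using p(1) by (auto simp: I'_def)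
  show ?thesis
  proof (intro bexI[OF _ cp(1)] conjI allI impI)
    show "fls_nth (\<Sum>i\<in>I. kt_scale (c i) (h i)) l = 0" if "l < fls_subdegree (h p)" for l
      unfolding nth using p(2) that by (intro sum.neutral) fastforce
    have "(\<Sum>i\<in>I'. c i * fls_nth (h i) (fls_subdegree (h p))) =
        c p * fls_nth (h p) (fls_subdegree (h p))"
      using p(1) I'(1) lt by (subst sum.remove[of _ p]) auto
    then show "fls_nth (\<Sum>i\<in>I. kt_scale (c i) (h i)) (fls_subdegree (h p)) \<noteq> 0"
      unfolding nth using cp assms(3) by simp
  qed
qed

text \<open>Elements of distinct orders are independent, which bounds the number of orders by the
  dimension. Conversely, if a basis were larger than \<open>ords U\<close>, some nonzero combination
  of it would vanish at every order of \<open>U\<close>, hence at its own.\<close>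

lemma dim_eq_card_ords:
  assumes U: "kt.subspace (U::'k::field fls set)" and fd: "fin_dim kt_scale U"
  shows "finite (ords U)" "kt.dim U = card (ords U)"
proof -
  obtain B where B: "finite B" "kt.independent B" "kt.span B = U"
    using fd by (auto simp: fin_dim_def)
  have dim: "kt.dim U = card B" using kt.dim_span_eq_card_independent[OF B(2)] B(3) by simp
  have "\<forall>i\<in>ords U. \<exists>x\<in>U - {0}. fls_subdegree x = i" by (auto simp: ords_def)
  then obtain h where h: "\<And>i. i \<in> ords U \<Longrightarrow> h i \<in> U - {0}"
    "\<And>i. i \<in> ords U \<Longrightarrow> fls_subdegree (h i) = i" by metis
  have card_F: "card F \<le> card B" if F: "finite F" "F \<subseteq> ords U" for F
  proof (rule kt.card_independent_mod_le[where S = "{0}" and e = h and f = "\<lambda>b. b"])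
    show "\<exists>c. h i - (\<Sum>j\<in>B. kt_scale (c j) j) \<in> {0}" if "i \<in> F" for i
    proof -
      have "h i \<in> kt.span B" using h(1) that F B(3) by blast
      then show ?thesis using kt.span_finite[OF B(1)] by auto
    qed
    show "\<forall>i\<in>F. c i = 0" if "(\<Sum>i\<in>F. kt_scale (c i) (h i)) \<in> {0}" for c
    proof (rule ccontr)
      assume "\<not> (\<forall>i\<in>F. c i = 0)"
      then have "\<exists>i\<in>F. c i \<noteq> 0" by blast
      moreover have "inj_on (\<lambda>i. fls_subdegree (h i)) F"
        using h(2) F(2) by (intro inj_onI) (metis subsetD)
      moreover have "h i \<noteq> 0" if "i \<in> F" for i using h(1) that F(2) by blast
      ultimately have "(\<Sum>i\<in>F. kt_scale (c i) (h i)) \<noteq> 0"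
        using subdegree_sum_least[OF F(1), of h c] by fastforce
      then show False using that by simp
    qed
  qed (use F B in \<open>auto simp: kt.subspace_0\<close>)
  then show fin: "finite (ords U)"
    by (metis finite_if_finite_subsets_card_bdd)
  have "card B \<le> card (ords U)"
  proof (rule ccontr)
    assume "\<not> card B \<le> card (ords U)"
    then obtain c where c: "\<exists>b\<in>B. c b \<noteq> 0" "\<forall>j\<in>ords U. (\<Sum>b\<in>B. c b * fls_nth b j) = 0"
      using homogeneous_system_nontrivial_solution[OF fin B(1), of fls_nth] by auto
    let ?x = "\<Sum>b\<in>B. kt_scale (c b) b"
    have "?x \<in> U" unfolding B(3)[symmetric] by (intro kt.span_sum kt.span_scale kt.span_base)
    moreover have "fls_nth ?x j = 0" if "j \<in> ords U" for j
      using c(2) that by (simp add: fls_nth_sum)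
    ultimately have "?x = 0"
      unfolding ords_def using nth_fls_subdegree_nonzero[of ?x] by blast
    then show False using B(1,2) c(1) kt.independentD by blast
  qed
  moreover have "card (ords U) \<le> card B"
    using card_F fin by blast
  ultimately show "kt.dim U = card (ords U)" using dim by simp
qed

text \<open>The pole of \<open>v\<close> is removed one order at a time. An order occurring in
  \<open>U\<close> is cancelled by an element of \<open>U\<close>, a missing one by a monomial; so
  the monomials at the missing negative orders span the quotient.\<close>

lemma reduce_mod_plus_power_series:
  fixes v :: "'k::field fls"
  assumes U: "kt.subspace U" and fin: "finite ({..<0} - ords U)"
    and v: "\<And>i. i < - int n \<Longrightarrow> fls_nth v i = 0"
  shows "\<exists>c. v - (\<Sum>i\<in>{..<0} - ords U. kt_scale (c i) (fls_X_intpow i)) \<in> U + power_series"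
  using v
proof (induction n arbitrary: v)
  case 0
  then have "v \<in> power_series" by (simp add: power_series_iff)
  then have "0 + v \<in> U + power_series" using kt.subspace_0[OF U] by (intro set_plus_intro)
  then show ?case by (intro exI[of _ "\<lambda>_. 0"]) simp
next
  case (Suc n)
  let ?N = "{..<0} - ords U"
  define i where "i = - int (Suc n)"
  have S: "kt.subspace (U + power_series)" by (intro subspace_plus U subspace_power_series)
  have below: "fls_nth v j = 0" if "j < i" for j using Suc.prems that by (simp add: i_def)
  show ?case
  proof (cases "i \<in> ords U")
    case True
    then obtain h where h: "h \<in> U" "h \<noteq> 0" "fls_subdegree h = i" by (auto simp: ords_def)
    define d where "d = fls_nth v i / fls_nth h i"
    have hi: "fls_nth h i \<noteq> 0" using h nth_fls_subdegree_nonzero[OF h(2)] by simp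
    have "fls_nth (v - kt_scale d h) j = 0" if "j < - int n" for j
    proof -
      have "j < i \<or> j = i" using that by (auto simp: i_def)
      then show ?thesis using below[of j] hi h(3) by (auto simp: d_def)
    qed
    then obtain c where
      c: "v - kt_scale d h - (\<Sum>i\<in>?N. kt_scale (c i) (fls_X_intpow i)) \<in> U + power_series"
      using Suc.IH by blast
    have "kt_scale d h + 0 \<in> U + power_series"
      using kt.subspace_scale[OF U h(1)] kt.subspace_0[OF subspace_power_series]
      by (intro set_plus_intro)
    from kt.subspace_add[OF S c this] show ?thesis
      by (intro exI[of _ c]) (simp add: algebra_simps)
  next
    case False
    then have i: "i \<in> ?N" by (simp add: i_def)
    have "fls_nth (v - kt_scale (fls_nth v i) (fls_X_intpow i)) j = 0" if "j < - int n" for j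
    proof -
      have "j < i \<or> j = i" using that by (auto simp: i_def)
      then show ?thesis using below[of j] by auto
    qed
    then obtain c where c: "v - kt_scale (fls_nth v i) (fls_X_intpow i) -
        (\<Sum>i\<in>?N. kt_scale (c i) (fls_X_intpow i)) \<in> U + power_series"
      using Suc.IH by blast
    \<comment> \<open>The induction hypothesis does not exclude that \<open>c i\<close> is already
      nonzero, so the new coefficient is added to it.\<close>
    have "(\<Sum>l\<in>?N. kt_scale ((c(i := c i + fls_nth v i)) l) (fls_X_intpow l)) =
        kt_scale (c i + fls_nth v i) (fls_X_intpow i) +
        (\<Sum>l\<in>?N - {i}. kt_scale (c l) (fls_X_intpow l))"
      using fin i by (subst sum.remove[of _ i]) (auto intro!: sum.cong)
    also have "\<dots> = kt_scale (fls_nth v i) (fls_X_intpow i) +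
        (\<Sum>l\<in>?N. kt_scale (c l) (fls_X_intpow l))"
      using fin i by (subst sum.remove[of ?N i]) (auto simp: algebra_simps simp flip: fls_plus_const)
    finally show ?thesis using c by (intro exI[of _ "c(i := c i + fls_nth v i)"]) (simp add: algebra_simps)
  qed
qed

text \<open>The monomials t^i at the missing negative orders \<open>i\<close> form a basis of the
  quotient. For independence, write a combination in \<open>U + power_series\<close> as
  \<open>x + y\<close>: at negative orders \<open>x\<close> has the same coefficients as the
  combination, so \<open>x\<close> in \<open>U\<close> would have a missing order. As
  \<open>codim\<close> picks an unspecified basis, that basis is compared with the monomials in both
  directions.\<close>

lemma codim_eq_card_ords:
  assumes U: "kt.subspace (U::'k::field fls set)" and fc: "fin_codim kt_scale (U + power_series)"
  shows "finite ({..<0} - ords U)" "codim kt_scale (U + power_series) = card ({..<0} - ords U)"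
proof -
  let ?S = "U + power_series" and ?N = "{..<0} - ords U"
  define B where "B = (SOME B. finite_quotient_basis kt_scale ?S B)"
  have "finite_quotient_basis kt_scale ?S B"
    unfolding B_def using fc unfolding fin_codim_def by (rule someI_ex)
  then have B: "finite B" "\<And>v. \<exists>c. v - (\<Sum>b\<in>B. kt_scale (c b) b) \<in> ?S"
    "\<And>c. (\<Sum>b\<in>B. kt_scale (c b) b) \<in> ?S \<Longrightarrow> \<forall>b\<in>B. c b = 0"
    by (simp_all add: finite_quotient_basis_def)
  have S: "kt.subspace ?S" by (intro subspace_plus U subspace_power_series)
  have card_F: "card F \<le> card B" if F: "finite F" "F \<subseteq> ?N" for F
  proof (rule kt.card_independent_mod_le[where S = ?S and e = fls_X_intpow and f = "\<lambda>b. b"])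
    show "\<forall>i\<in>F. c i = 0" if mem: "(\<Sum>i\<in>F. kt_scale (c i) (fls_X_intpow i)) \<in> ?S" for c :: "int \<Rightarrow> 'k"
    proof (rule ccontr)
      have deg: "fls_subdegree (fls_X_intpow i :: 'k fls) = i" for i
        by (intro fls_subdegree_eqI) auto
      assume "\<not> (\<forall>i\<in>F. c i = 0)"
      then have "\<exists>i\<in>F. c i \<noteq> 0" by blast
      then obtain p where p: "p \<in> F"
        "\<forall>l<p. fls_nth (\<Sum>i\<in>F. kt_scale (c i) (fls_X_intpow i)) l = 0"
        "fls_nth (\<Sum>i\<in>F. kt_scale (c i) (fls_X_intpow i)) p \<noteq> 0"
        using subdegree_sum_least[OF F(1), of "fls_X_intpow :: int \<Rightarrow> 'k fls" c]
        unfolding deg by (auto simp: inj_on_def)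
      obtain x y where xy: "x \<in> U" "y \<in> power_series"
        "(\<Sum>i\<in>F. kt_scale (c i) (fls_X_intpow i)) = x + y" using mem by (auto elim: set_plus_elim)
      have "p < 0" "p \<notin> ords U" using p(1) F by auto
      have "fls_nth x l = fls_nth (\<Sum>i\<in>F. kt_scale (c i) (fls_X_intpow i)) l" if "l \<le> p" for l
        unfolding xy(3) using xy(2) that \<open>p < 0\<close> by (simp add: power_series_iff)
      then have "fls_subdegree x = p" "x \<noteq> 0" using p by (auto intro: fls_subdegree_eqI)
      then show False using \<open>p \<notin> ords U\<close> xy(1) by (auto simp: ords_def)
    qed
  qed (use F B S in auto)
  then show fin: "finite ?N" by (metis finite_if_finite_subsets_card_bdd)
  have "card B \<le> card ?N"
  proof (rule kt.card_independent_mod_le[where S = ?S and e = "\<lambda>b. b" and f = fls_X_intpow])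
    show "\<exists>c. v - (\<Sum>i\<in>?N. kt_scale (c i) (fls_X_intpow i)) \<in> ?S" for v
      by (rule reduce_mod_plus_power_series[OF U fin, of "nat (- fls_subdegree v)"],
          rule fls_eq0_below_subdegree) linarith
  qed (use B S fin in auto)
  moreover have "card ?N \<le> card B"
    using card_F fin by blast
  ultimately show "codim kt_scale ?S = card ?N" by (simp add: codim_def B_def)
qed

text \<open>Far to the right \<open>U\<close> has no orders and far to the left it has all of them,
  so a large window contains the nonnegative orders and all but the missing ones of the
  \<open>M\<close> negative places. The two ends vary independently because a shifted window is no
  longer symmetric.\<close>

lemma euler_char_eq_card_window:
  assumes "fredholm U"
  shows "\<exists>L\<ge>0. \<forall>M\<ge>L. \<forall>K\<ge>L. euler_char U = int (card (ords U \<inter> {-M..<K})) - M"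
proof -
  have U: "kt.subspace U" "fin_dim kt_scale (U \<inter> power_series)" "fin_codim kt_scale (U + power_series)"
    using assms by (auto simp: fredholm_def)
  let ?P = "ords U \<inter> {0..}" and ?N = "{..<0} - ords U"
  have P: "ords (U \<inter> power_series) = ?P"
  proof (intro equalityI subsetI)
    fix i assume "i \<in> ords (U \<inter> power_series)"
    then obtain x where "x \<in> U" "x \<in> power_series" "x \<noteq> 0" "i = fls_subdegree x"
      by (auto simp: ords_def)
    then show "i \<in> ?P" by (auto simp: ords_def power_series_iff intro: fls_subdegree_ge0I)
  next
    fix i assume "i \<in> ?P"
    then obtain x where "x \<in> U" "x \<noteq> 0" "i = fls_subdegree x" "fls_subdegree x \<ge> 0"
      by (auto simp: ords_def)
    then show "i \<in> ords (U \<inter> power_series)"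
      unfolding ords_def by (intro image_eqI[of _ _ x]) (auto simp: power_series_iff)
  qed
  note dim = dim_eq_card_ords[OF kt.subspace_inter[OF U(1) subspace_power_series] U(2), unfolded P]
  note codim = codim_eq_card_ords[OF U(1,3)]
  \<comment> \<open>Inserting 0 keeps \<open>Max\<close> meaningful when there are no exceptional
    orders; adding 1 makes the bound strict, as the excluded right end of the window
    demands.\<close>
  define L where "L = Max (insert 0 (abs ` (?P \<union> ?N))) + 1"
  have L: "\<bar>i\<bar> < L" if "i \<in> ?P \<union> ?N" for i
  proof -
    have "\<bar>i\<bar> \<le> Max (insert 0 (abs ` (?P \<union> ?N)))"
      using that dim(1) codim(1) by (intro Max_ge finite.insertI finite_imageI) auto
    then show ?thesis by (simp add: L_def)
  qed
  show ?thesis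
  proof (intro exI[of _ "max L 0"] conjI allI impI)
    fix M K assume MK: "max L 0 \<le> M" "max L 0 \<le> K"
    have N_subset: "?N \<subseteq> {-M..<0}"
    proof
      fix i assume "i \<in> ?N"
      then show "i \<in> {-M..<0}" using L[of i] MK by auto
    qed
    have "ords U \<inter> {-M..<K} = ?P \<union> ({-M..<0} - ?N)"
    proof (intro equalityI subsetI)
      fix i assume "i \<in> ?P \<union> ({-M..<0} - ?N)"
      then show "i \<in> ords U \<inter> {-M..<K}" using L[of i] MK by auto
    qed auto
    then have "card (ords U \<inter> {-M..<K}) = card ?P + card ({-M..<0} - ?N)"
      using dim(1) by (simp add: card_Un_disjoint disjoint_iff)
    also have "card ({-M..<0} - ?N) = card {-M..<0} - card ?N"
      using N_subset codim(1) by (intro card_Diff_subset)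
    also have "card {-M..<0} = nat M" by simp
    finally have "int (card (ords U \<inter> {-M..<K})) = int (card ?P) + (M - int (card ?N))"
      using MK card_mono[OF _ N_subset] by simp
    then show "euler_char U = int (card (ords U \<inter> {-M..<K})) - M"
      by (simp add: euler_char_def dim codim)
  qed simp
qed

text \<open>Multiplication by \<open>c\<close> moves orders by \<open>?l\<close>, so the window of
  \<open>U\<close> that lands in \<open>{-M..<M}\<close> starts at \<open>-(M + ?l)\<close>. The
  correction term \<open>M + ?l\<close> in its count produces the gain \<open>?l\<close>.\<close>

lemma euler_char_shift_le:
  fixes c :: "'k::field fls"
  assumes U: "fredholm U" "fredholm U'" and c: "c \<noteq> 0" "\<And>x. x \<in> U \<Longrightarrow> c * x \<in> U'"
  shows "euler_char U + fls_subdegree c \<le> euler_char U'"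
proof -
  let ?l = "fls_subdegree c"
  obtain L where L: "L \<ge> 0"
    "\<And>M K. M \<ge> L \<Longrightarrow> K \<ge> L \<Longrightarrow> euler_char U = int (card (ords U \<inter> {-M..<K})) - M"
    using euler_char_eq_card_window[OF U(1)] by blast
  obtain L' where L': "L' \<ge> 0"
    "\<And>M K. M \<ge> L' \<Longrightarrow> K \<ge> L' \<Longrightarrow> euler_char U' = int (card (ords U' \<inter> {-M..<K})) - M"
    using euler_char_eq_card_window[OF U(2)] by blast
  \<comment> \<open>Large enough that \<open>M + ?l\<close>, \<open>M - ?l\<close> and
    \<open>M\<close> all lie in the range where the window formulas hold.\<close>
  define M where "M = L + L' + \<bar>?l\<bar>"
  have "(\<lambda>i. i + ?l) ` (ords U \<inter> {-(M + ?l)..<M - ?l}) \<subseteq> ords U' \<inter> {-M..<M}"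
  proof (intro image_subsetI)
    fix i assume i: "i \<in> ords U \<inter> {-(M + ?l)..<M - ?l}"
    then obtain x where "x \<in> U" "x \<noteq> 0" "i = fls_subdegree x" by (auto simp: ords_def)
    then have "i + ?l \<in> ords U'" using c unfolding ords_def
      by (intro image_eqI[of _ _ "c * x"]) auto
    then show "i + ?l \<in> ords U' \<inter> {-M..<M}" using i by auto
  qed
  then have "card ((\<lambda>i. i + ?l) ` (ords U \<inter> {-(M + ?l)..<M - ?l})) \<le> card (ords U' \<inter> {-M..<M})"
    by (intro card_mono) auto
  then have "card (ords U \<inter> {-(M + ?l)..<M - ?l}) \<le> card (ords U' \<inter> {-M..<M})"
    by (subst (asm) card_image) (auto intro: inj_onI)
  then show ?thesis
    using L(2)[of "M + ?l" "M - ?l"] L'(2)[of M M] L(1) L'(1) by (simp add: M_def)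
qed

section \<open>Graded pieces and multiplication by leading coefficients\<close>

lemma mem_graded_piece:
  "y \<in> graded_piece W n \<longleftrightarrow> (\<exists>w\<in>W. (\<forall>i<n. fls_nth w i = 0) \<and> fls_nth w n = y)"
proof -
  have "w \<in> fls_X_intpow n *o O1 \<longleftrightarrow> (\<forall>i<n. fls_nth w i = 0)" for w :: "'a fls fls"
  proof
    assume l: "\<forall>i<n. fls_nth w i = 0"
    have "fls_shift n w = fps_to_fls (fls_regpart (fls_shift n w))"
      using l by (intro fls_regpart_to_fls_trivial[symmetric] fls_subdegree_ge0I) auto
    moreover have "w = fls_X_intpow n * fls_shift n w"
      by (simp add: fls_X_intpow_times_conv_shift)
    ultimately show "w \<in> fls_X_intpow n *o O1" unfolding O1_def elt_set_times_def by blast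
  qed (auto simp: O1_def elt_set_times_def fls_X_intpow_times_conv_shift)
  then show ?thesis by (auto simp: graded_piece_def image_iff Bex_def)
qed

text \<open>If \<open>w\<close> represents a nonzero \<open>y\<close>, its order is exactly
  \<open>n\<close>, and leading coefficients multiply. If \<open>y = 0\<close>, the order of
  \<open>w\<close> exceeds \<open>n\<close> (or \<open>w = 0\<close>), and the coefficient of the
  product at \<open>n + \<nu> x\<close> vanishes as it should.\<close>

lemma graded_piece_mult:
  fixes x :: "'k::field fls fls"
  assumes "x \<noteq> 0" "\<And>w. w \<in> W \<Longrightarrow> x * w \<in> W" "y \<in> graded_piece W n"
  shows "fls_nth x (\<nu> x) * y \<in> graded_piece W (n + \<nu> x)"
proof -
  obtain w where w: "w \<in> W" "\<forall>i<n. fls_nth w i = 0" "fls_nth w n = y"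
    using assms(3) by (auto simp: mem_graded_piece)
  have "fls_nth (x * w) i = 0" if "i < n + \<nu> x" for i
  proof (cases "w = 0")
    case False
    then have "n \<le> fls_subdegree w" using w(2) by (intro fls_subdegree_geI) auto
    then show ?thesis using that by (intro fls_times_nth_eq0) (simp add: \<nu>_def)
  qed simp
  moreover have "fls_nth (x * w) (n + \<nu> x) = fls_nth x (\<nu> x) * y"
  proof (cases "y = 0")
    case True
    show ?thesis
    proof (cases "w = 0")
      case False
      then have "n < fls_subdegree w"
        using w True fls_subdegree_geI[of w n] nth_fls_subdegree_nonzero[of w] by (metis order_le_less)
      then show ?thesis using True by (simp add: \<nu>_def fls_times_nth_eq0)
    qed (use True in simp)
  next
    case False
    then have "fls_subdegree w = n" using w by (intro fls_subdegree_eqI) auto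
    then show ?thesis using fls_times_base[of x w] w(3) by (simp add: \<nu>_def add.commute)
  qed
  ultimately show ?thesis using assms(2) w(1) by (auto simp: mem_graded_piece)
qed

section \<open>Subrings, subfields and fields of fractions\<close>

lemma
  assumes "is_subring R"
  shows is_subring_sum: "(\<And>i. i \<in> I \<Longrightarrow> f i \<in> R) \<Longrightarrow> sum f I \<in> R"
    and is_subring_diff: "x \<in> R \<Longrightarrow> y \<in> R \<Longrightarrow> x - y \<in> R"
    and is_subring_power: "x \<in> R \<Longrightarrow> x ^ n \<in> R"
proof -
  show "(\<And>i. i \<in> I \<Longrightarrow> f i \<in> R) \<Longrightarrow> sum f I \<in> R"
    using assms by (induction I rule: infinite_finite_induct) (auto simp: is_subring_def)
  show "x - y \<in> R" if "x \<in> R" "y \<in> R"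
    using assms that unfolding is_subring_def by (metis diff_conv_add_uminus)
  show "x \<in> R \<Longrightarrow> x ^ n \<in> R"
    using assms by (induction n) (auto simp: is_subring_def)
qed

lemma is_subring_prod:
  fixes f :: "'i \<Rightarrow> 'v::comm_ring_1"
  assumes "is_subring R" "\<And>i. i \<in> I \<Longrightarrow> f i \<in> R"
  shows "prod f I \<in> R"
  using assms(2) by (induction I rule: infinite_finite_induct) (use assms(1) in \<open>auto simp: is_subring_def\<close>)

lemma is_subfield_divide: "is_subfield F \<Longrightarrow> x \<in> F \<Longrightarrow> y \<in> F \<Longrightarrow> x / y \<in> F"
  by (simp add: is_subfield_def is_subring_def divide_inverse)

lemma is_subfield_hull: "is_subfield (is_subfield hull S)"
  by (rule hull_in) (auto simp: is_subfield_def is_subring_def)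

lemma is_subring_hull: "is_subring (is_subfield hull S)"
  using is_subfield_hull by (auto simp: is_subfield_def)

lemma subset_Frac: "is_subring R \<Longrightarrow> R \<subseteq> Frac R"
  by (force simp: Frac_def is_subring_def)

lemma is_subfield_Frac:
  assumes R: "is_subring (R :: 'v::field set)"
  shows "is_subfield (Frac R)"
proof -
  have closed: "0 \<in> R" "1 \<in> R" "\<And>x. x \<in> R \<Longrightarrow> - x \<in> R"
    "\<And>x y. x \<in> R \<Longrightarrow> y \<in> R \<Longrightarrow> x + y \<in> R" "\<And>x y. x \<in> R \<Longrightarrow> y \<in> R \<Longrightarrow> x * y \<in> R"
    using R by (auto simp: is_subring_def)
  have I: "x / y \<in> Frac R" if "x \<in> R" "y \<in> R" "y \<noteq> 0" for x y
    using that by (auto simp: Frac_def)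
  have E: "\<exists>p q. p \<in> R \<and> q \<in> R \<and> q \<noteq> 0 \<and> x = p / q" if "x \<in> Frac R" for x
    using that by (auto simp: Frac_def)
  have "0 \<in> Frac R" "1 \<in> Frac R" using subset_Frac[OF R] closed by auto
  moreover have "- x \<in> Frac R" "inverse x \<in> Frac R" if x: "x \<in> Frac R" for x
  proof -
    obtain p q where pq: "p \<in> R" "q \<in> R" "q \<noteq> 0" "x = p / q" using E[OF x] by blast
    then show "- x \<in> Frac R" using I[of "- p" q] closed by simp
    show "inverse x \<in> Frac R"
      using pq I[of q p] \<open>0 \<in> Frac R\<close> by (cases "p = 0") auto
  qed
  moreover have "x + y \<in> Frac R \<and> x * y \<in> Frac R" if xy: "x \<in> Frac R" "y \<in> Frac R" for x y
  proof -
    obtain p q where pq: "p \<in> R" "q \<in> R" "q \<noteq> 0" "x = p / q" using E[OF xy(1)] by blast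
    obtain p' q' where pq': "p' \<in> R" "q' \<in> R" "q' \<noteq> 0" "y = p' / q'" using E[OF xy(2)] by blast
    have "x + y = (p * q' + p' * q) / (q * q')" "x * y = (p * p') / (q * q')"
      using pq pq' by (simp_all add: add_frac_eq)
    then show ?thesis using I[of "p * q' + p' * q" "q * q'"] I[of "p * p'" "q * q'"] pq pq' closed
      by simp
  qed
  ultimately show ?thesis by (auto simp: is_subfield_def is_subring_def)
qed

lemma common_denominator:
  assumes R: "is_subring (R :: 'v::field set)" and S: "finite S" "S \<subseteq> Frac R"
  shows "\<exists>d\<in>R. d \<noteq> 0 \<and> (\<forall>s\<in>S. s * d \<in> R)"
  using S
proof (induction S rule: finite_induct)
  case empty
  then show ?case using R by (intro bexI[of _ 1]) (auto simp: is_subring_def)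
next
  case (insert s S)
  then obtain d where d: "d \<in> R" "d \<noteq> 0" "\<forall>s\<in>S. s * d \<in> R" by auto
  obtain p q where pq: "p \<in> R" "q \<in> R" "q \<noteq> 0" "s = p / q"
    using insert.prems by (auto simp: Frac_def)
  have "t * (d * q) \<in> R" if "t \<in> insert s S" for t
  proof (cases "t = s")
    case True
    then have "t * (d * q) = p * d" using pq by (simp add: mult.commute)
    then show ?thesis using R pq d unfolding is_subring_def by metis
  next
    case False
    then have "(t * d) * q \<in> R" using R pq d that by (simp add: is_subring_def)
    then show ?thesis by (simp add: mult.assoc)
  qed
  then show ?case using R d pq by (intro bexI[of _ "d * q"]) (auto simp: is_subring_def)
qed

text \<open>A subfield containing \<open>R\<close> contains all its quotients, so it suffices to
  capture \<open>R\<close> itself in a finitely generated field.\<close>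

lemma finitely_generated_Frac:
  assumes R: "is_subring R" "range \<iota> \<subseteq> R"
    and S: "finite S" "S \<subseteq> R" "R \<subseteq> is_subfield hull (range \<iota> \<union> S)"
  shows "finitely_generated_field \<iota> (Frac R)"
proof -
  have "Frac R \<subseteq> is_subfield hull (range \<iota> \<union> S)"
    unfolding Frac_def using S(3) by (blast intro: is_subfield_divide is_subfield_hull)
  moreover have "is_subfield hull (range \<iota> \<union> S) \<subseteq> Frac R"
    using subset_Frac[OF R(1)] R S by (intro hull_minimal is_subfield_Frac) auto
  ultimately show ?thesis using S(1) by (auto simp: finitely_generated_field_def)
qed

section \<open>Pole order in \<open>u\<close>\<close>

text \<open>This is u^(-n) k((t))[[u]], described by coefficients so that 0 needs no separate
  treatment.\<close>

definition pole_le :: "nat \<Rightarrow> 'k::field fls fls set" where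
  "pole_le n = {x. \<forall>i < - int n. fls_nth x i = 0}"

lemma pole_le_iff: "x \<in> pole_le n \<longleftrightarrow> x = 0 \<or> - int n \<le> \<nu> x"
  using fls_subdegree_geI[of x "- int n"] by (auto simp: pole_le_def \<nu>_def)

lemma pole_le_mono: "m \<le> n \<Longrightarrow> pole_le m \<subseteq> pole_le n"
  by (auto simp: pole_le_def)

lemma pole_le_mult: "x \<in> pole_le m \<Longrightarrow> y \<in> pole_le n \<Longrightarrow> x * y \<in> pole_le (m + n)"
  by (cases "x = 0 \<or> y = 0") (auto simp: pole_le_iff \<nu>_def)

lemma pole_le_const2: "const2 c \<in> pole_le 0"
  by (auto simp: pole_le_def const2_def)

lemma pole_le_power: "x \<in> pole_le m \<Longrightarrow> x ^ n \<in> pole_le (n * m)"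
proof (induction n)
  case 0
  then show ?case by (simp add: pole_le_def)
next
  case (Suc n)
  then show ?case using pole_le_mult[of x m "x ^ n" "n * m"] by simp
qed

lemma pole_le_prod: "(\<And>i. i \<in> I \<Longrightarrow> f i \<in> pole_le n) \<Longrightarrow> prod f I \<in> pole_le (card I * n)"
proof (induction I rule: infinite_finite_induct)
  case (insert i I)
  then show ?case using pole_le_mult[of "f i" n "prod f I" "card I * n"] by simp
qed (auto simp: pole_le_def)

lemma finite_subset_pole_le: "finite S \<Longrightarrow> \<exists>n. S \<subseteq> pole_le n"
proof (induction S rule: finite_induct)
  case (insert x S)
  then obtain n where "S \<subseteq> pole_le n" by blast
  moreover have "x \<in> pole_le (nat (- \<nu> x))" by (simp add: pole_le_iff)
  ultimately show ?case
    using pole_le_mono[of n "max n (nat (- \<nu> x))"] pole_le_mono[of "nat (- \<nu> x)" "max n (nat (- \<nu> x))"]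
    by (intro exI[of _ "max n (nat (- \<nu> x))"]) auto
qed simp

section \<open>The rank two valuation\<close>

text \<open>The pair is the rank two valuation of k((t))((u)), ordered lexicographically; 0 has no
  value.\<close>

definition value_set :: "'k::field fls fls set \<Rightarrow> (int \<times> int) set" where
  "value_set U = (\<lambda>x. (\<nu> x, \<nu>_bar x)) ` (U - {0})"

text \<open>Independence of a family rather than of a set, so that members can be counted by their
  indices without first proving them distinct. It is meant for finite \<open>I\<close>.\<close>

definition lin_indep :: "('i \<Rightarrow> 'k::field fls fls) \<Rightarrow> 'i set \<Rightarrow> bool" where
  "lin_indep e I \<longleftrightarrow> (\<forall>c. (\<Sum>i\<in>I. V_scale (c i) (e i)) = 0 \<longrightarrow> (\<forall>i\<in>I. c i = 0))"

lemma V_scale_nth [simp]: "fls_nth (fls_nth (V_scale c x) n) l = c * fls_nth (fls_nth x n) l"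
  by (simp add: const2_def)

lemma leading_coeff_nonzero:
  "x \<noteq> 0 \<Longrightarrow> fls_nth (fls_nth x (\<nu> x)) (\<nu>_bar x) \<noteq> 0"
  by (simp add: \<nu>_def \<nu>_bar_def)

lemma
  fixes x y :: "'k::field fls fls"
  assumes "x \<noteq> 0" "y \<noteq> 0"
  shows \<nu>_mult: "\<nu> (x * y) = \<nu> x + \<nu> y" and \<nu>_bar_mult: "\<nu>_bar (x * y) = \<nu>_bar x + \<nu>_bar y"
  using assms by (simp_all add: \<nu>_def \<nu>_bar_def)

lemma
  fixes x :: "'k::field fls fls"
  assumes "x \<noteq> 0"
  shows \<nu>_power: "\<nu> (x ^ n) = int n * \<nu> x" and \<nu>_bar_power: "\<nu>_bar (x ^ n) = int n * \<nu>_bar x"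
proof -
  have "\<nu> (x ^ n) = int n * \<nu> x \<and> \<nu>_bar (x ^ n) = int n * \<nu>_bar x"
  proof (induction n)
    case (Suc n)
    then show ?case using assms by (simp add: \<nu>_mult \<nu>_bar_mult algebra_simps)
  qed (simp add: \<nu>_def \<nu>_bar_def)
  then show "\<nu> (x ^ n) = int n * \<nu> x" "\<nu>_bar (x ^ n) = int n * \<nu>_bar x" by auto
qed

text \<open>With more vectors than values, a nonzero combination could be made to vanish at all
  positions in \<open>T\<close>; but its leading coefficient sits at its own value, which belongs to
  \<open>T\<close>.\<close>

lemma card_lin_indep_le:
  assumes U: "V.subspace U" and fin: "finite I" "finite T"
    and e: "\<And>i. i \<in> I \<Longrightarrow> e i \<in> U" "lin_indep e I" and T: "value_set U \<subseteq> T"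
  shows "card I \<le> card T"
proof (rule ccontr)
  assume "\<not> card I \<le> card T"
  then obtain c where c: "\<exists>i\<in>I. c i \<noteq> 0"
    "\<forall>p\<in>T. (\<Sum>i\<in>I. c i * fls_nth (fls_nth (e i) (fst p)) (snd p)) = 0"
    using homogeneous_system_nontrivial_solution[OF fin(2,1),
        of "\<lambda>i p. fls_nth (fls_nth (e i) (fst p)) (snd p)"] by auto
  let ?x = "\<Sum>i\<in>I. V_scale (c i) (e i)"
  have "?x \<noteq> 0" using c(1) e(2) by (auto simp: lin_indep_def)
  moreover have "?x \<in> U" using U e(1) by (intro V.subspace_sum V.subspace_scale)
  ultimately have "(\<nu> ?x, \<nu>_bar ?x) \<in> T" using T by (auto simp: value_set_def)
  then have "fls_nth (fls_nth ?x (\<nu> ?x)) (\<nu>_bar ?x) = 0"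
    using c(2) by (fastforce simp: fls_nth_sum simp del: fls_mult_const_nth)
  then show False using leading_coeff_nonzero[OF \<open>?x \<noteq> 0\<close>] by simp
qed

text \<open>Among the terms with nonzero coefficient, let \<open>(m, l)\<close> be the
  lexicographically least value. Every other term has zero coefficient at u^m t^l, so the one term
  with this value cannot be cancelled.\<close>

lemma lin_indep_if_distinct_values:
  fixes e :: "'i \<Rightarrow> 'k::field fls fls"
  assumes fin: "finite I" and nz: "\<And>i. i \<in> I \<Longrightarrow> e i \<noteq> 0"
    and inj: "inj_on (\<lambda>i. (\<nu> (e i), \<nu>_bar (e i))) I"
  shows "lin_indep e I"
  unfolding lin_indep_def
proof (intro allI impI, rule ccontr)
  fix c :: "'i \<Rightarrow> 'k"
  assume sum: "(\<Sum>i\<in>I. V_scale (c i) (e i)) = 0" and "\<not> (\<forall>i\<in>I. c i = 0)"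
  define I' where "I' = {i\<in>I. c i \<noteq> 0}"
  have I': "finite I'" "I' \<noteq> {}" "I' \<subseteq> I" using fin \<open>\<not> _\<close> by (auto simp: I'_def)
  define m where "m = Min ((\<lambda>i. \<nu> (e i)) ` I')"
  define J where "J = {i\<in>I'. \<nu> (e i) = m}"
  have "m \<in> (\<lambda>i. \<nu> (e i)) ` I'" unfolding m_def using I' by (intro Min_in) auto
  then have J: "finite J" "J \<noteq> {}" using I' by (auto simp: J_def)
  define l where "l = Min ((\<lambda>i. \<nu>_bar (e i)) ` J)"
  have "l \<in> (\<lambda>i. \<nu>_bar (e i)) ` J" unfolding l_def using J by (intro Min_in) auto
  then obtain p where p: "p \<in> I'" "\<nu> (e p) = m" "\<nu>_bar (e p) = l" by (auto simp: J_def)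
  have zero: "fls_nth (fls_nth (e i) m) l = 0" if i: "i \<in> I'" "i \<noteq> p" for i
  proof -
    have "m \<le> \<nu> (e i)" unfolding m_def using I' i by (intro Min_le) auto
    moreover have "fls_nth (e i) m = 0" if "m < \<nu> (e i)" using that by (simp add: \<nu>_def)
    moreover have "fls_nth (fls_nth (e i) m) l = 0" if "\<nu> (e i) = m"
    proof -
      have "l \<le> \<nu>_bar (e i)" unfolding l_def using J i that by (intro Min_le) (auto simp: J_def)
      moreover have "l \<noteq> \<nu>_bar (e i)"
        using inj_onD[OF inj, of i p] that p i subsetD[OF I'(3)] by auto
      ultimately show ?thesis using that by (auto simp: \<nu>_bar_def)
    qed
    ultimately show ?thesis by fastforce
  qed
  have "0 = fls_nth (fls_nth (\<Sum>i\<in>I. V_scale (c i) (e i)) m) l" by (simp add: sum)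
  also have "\<dots> = (\<Sum>i\<in>I. c i * fls_nth (fls_nth (e i) m) l)" by (simp only: fls_nth_sum V_scale_nth)
  also have "\<dots> = (\<Sum>i\<in>I'. c i * fls_nth (fls_nth (e i) m) l)"
    unfolding I'_def using fin by (intro sum.mono_neutral_right) auto
  also have "\<dots> = c p * fls_nth (fls_nth (e p) m) l"
    using I'(1) p(1) zero by (subst sum.remove[of _ p]) auto
  finally show False
    using p nz[of p] leading_coeff_nonzero[of "e p"] by (auto simp: I'_def)
qed

text \<open>In a relation between the \<open>g j\<close> over \<open>F 0\<close>, the last \<open>g q\<close> that occurs would lie in \<open>F q\<close>.\<close>

lemma lin_indep_field_extension:
  fixes g :: "nat \<Rightarrow> 'k::field fls fls"
  assumes F: "\<And>j. is_subfield (F j)" "\<And>i j. i \<le> j \<Longrightarrow> F i \<subseteq> F j" "range const2 \<subseteq> F 0"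
    and g: "\<And>j. j < r \<Longrightarrow> g j \<notin> F j" "\<And>i j. i < j \<Longrightarrow> j < r \<Longrightarrow> g i \<in> F j"
    and E: "finite I" "\<And>i. i \<in> I \<Longrightarrow> E i \<in> F 0" "lin_indep E I"
  shows "lin_indep (\<lambda>(i, j). E i * g j) (I \<times> {..<r})"
  unfolding lin_indep_def
proof (intro allI impI)
  fix c :: "'a \<times> nat \<Rightarrow> 'k"
  define P where "P j = (\<Sum>i\<in>I. V_scale (c (i, j)) (E i))" for j
  have ring: "is_subring (F j)" for j using F(1) by (simp add: is_subfield_def)
  have P: "P j \<in> F 0" for j
    unfolding P_def
  proof (intro is_subring_sum ring)
    fix i assume "i \<in> I"
    then show "V_scale (c (i, j)) (E i) \<in> F 0"
      using subsetD[OF F(3) rangeI] E(2) ring[of 0] unfolding is_subring_def by blast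
  qed
  assume "(\<Sum>p\<in>I \<times> {..<r}. V_scale (c p) (case p of (i, j) \<Rightarrow> E i * g j)) = 0"
  also have "(\<Sum>p\<in>I \<times> {..<r}. V_scale (c p) (case p of (i, j) \<Rightarrow> E i * g j)) =
      (\<Sum>i\<in>I. \<Sum>j<r. V_scale (c (i, j)) (E i) * g j)"
    by (subst sum.cartesian_product) (auto intro!: sum.cong simp: mult.assoc)
  also have "\<dots> = (\<Sum>j<r. P j * g j)"
    by (subst sum.swap) (simp add: P_def sum_distrib_right)
  finally have sum: "(\<Sum>j<r. P j * g j) = 0" .
  have "P j = 0" if "j < r" for j
  proof (rule ccontr)
    assume "P j \<noteq> 0"
    define S where "S = {j\<in>{..<r}. P j \<noteq> 0}"
    define q where "q = Max S"
    have S: "finite S" "S \<noteq> {}" using \<open>P j \<noteq> 0\<close> that by (auto simp: S_def)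
    then have "q \<in> S" unfolding q_def by (rule Max_in)
    then have q: "q < r" "P q \<noteq> 0" by (auto simp: S_def)
    have above: "P i = 0" if "q < i" "i < r" for i
    proof -
      have "i \<notin> S" using Max_ge[OF S(1), of i] that(1) by (auto simp: q_def)
      then show ?thesis using that(2) by (simp add: S_def)
    qed
    have "(\<Sum>j<r. P j * g j) = (\<Sum>j\<le>q. P j * g j)"
      using q(1) above by (intro sum.mono_neutral_right) auto
    also have "\<dots> = (\<Sum>j<q. P j * g j) + P q * g q"
      by (simp flip: lessThan_Suc_atMost)
    finally have "g q = (0 - (\<Sum>j<q. P j * g j)) / P q"
      using sum q(2) by (simp add: field_simps eq_neg_iff_add_eq_0 add.commute)
    also have "\<dots> \<in> F q"
    proof (intro is_subfield_divide F(1) is_subring_diff ring is_subring_sum)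
      show "P q \<in> F q" using P F(2)[of 0 q] by auto
      show "P j * g j \<in> F q" if "j \<in> {..<q}" for j
        using P[of j] F(2)[of 0 q] g(2)[of j q] that q(1) ring[of q] by (auto simp: is_subring_def)
      show "0 \<in> F q" using ring[of q] by (simp add: is_subring_def)
    qed
    finally show False using g(1) q(1) by blast
  qed
  then have "\<forall>i\<in>I. c (i, j) = 0" if "j < r" for j
    using E(3)[unfolded lin_indep_def, rule_format, of "\<lambda>i. c (i, j)"] that by (auto simp: P_def)
  then show "\<forall>p\<in>I \<times> {..<r}. c p = 0" by auto
qed


section \<open>Consequences of bounded growth\<close>

text \<open>A linear relation between the monomials is a polynomial relation between the elements of
  \<open>S\<close>; the proof only translates exponent functions into keys of a polynomial.\<close>

lemma lin_indep_monomials: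
  fixes S :: "'k::field fls fls set"
  assumes S: "finite S" "algebraically_independent const2 S"
  shows "lin_indep (\<lambda>f. \<Prod>s\<in>S. s ^ f s) (S \<rightarrow>\<^sub>E {..<N})"
  unfolding lin_indep_def
proof (intro allI impI)
  let ?F = "S \<rightarrow>\<^sub>E {..<N}"
  fix c :: "('k fls fls \<Rightarrow> nat) \<Rightarrow> 'k"
  assume sum: "(\<Sum>f\<in>?F. V_scale (c f) (\<Prod>s\<in>S. s ^ f s)) = 0"
  \<comment> \<open>Functions in \<open>?F\<close> are \<open>undefined\<close> off
    \<open>S\<close>, so they are cut off to 0 there to have finite support; extensionality makes
    \<open>mon\<close> injective on \<open>?F\<close>.\<close>
  define mon where "mon f = Abs_poly_mapping (\<lambda>s. if s \<in> S then f s else 0)"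
    for f :: "'k fls fls \<Rightarrow> nat"
  have lookup_mon: "Poly_Mapping.lookup (mon f) s = (if s \<in> S then f s else 0)" for f s
    using S(1) by (simp add: mon_def)
  have keys_mon: "Poly_Mapping.keys (mon f) \<subseteq> S" for f
    by (auto simp: in_keys_iff lookup_mon split: if_splits)
  have inj: "inj_on mon ?F"
  proof (rule inj_onI)
    fix f g assume fg: "f \<in> ?F" "g \<in> ?F" "mon f = mon g"
    then show "f = g" using lookup_mon by (intro PiE_ext[OF fg(1,2)]) metis
  qed
  have fin: "finite ?F" using S(1) by (intro finite_PiE) auto
  define p where "p = (\<Sum>f\<in>?F. Poly_Mapping.single (mon f) (c f))"
  have lookup_p: "Poly_Mapping.lookup p (mon f) = c f" if "f \<in> ?F" for f
  proof -
    have "Poly_Mapping.lookup p (mon f) = (\<Sum>g\<in>?F. if g = f then c g else 0)"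
      unfolding p_def lookup_sum using inj that
      by (intro sum.cong) (auto simp: lookup_single when_def inj_on_def)
    then show ?thesis using fin that by simp
  qed
  have keys_p: "Poly_Mapping.keys p \<subseteq> mon ` ?F"
    unfolding p_def by (rule order_trans[OF keys_sum]) auto
  have mon_eval: "(\<Prod>i\<in>Poly_Mapping.keys (mon f). i ^ Poly_Mapping.lookup (mon f) i) = (\<Prod>s\<in>S. s ^ f s)" for f
    using S(1) keys_mon[of f]
    by (intro prod.mono_neutral_cong_left) (auto simp: in_keys_iff lookup_mon)
  have "mpoly_eval const2 (\<lambda>s. s) p = (\<Sum>m\<in>mon ` ?F. const2 (Poly_Mapping.lookup p m) *
      (\<Prod>i\<in>Poly_Mapping.keys m. i ^ Poly_Mapping.lookup m i))"
    unfolding mpoly_eval_def using keys_p fin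
    by (intro sum.mono_neutral_left) (auto simp: in_keys_iff const2_def)
  also have "\<dots> = (\<Sum>f\<in>?F. V_scale (c f) (\<Prod>s\<in>S. s ^ f s))"
    by (subst sum.reindex[OF inj]) (simp add: lookup_p mon_eval)
  finally have "mpoly_eval const2 (\<lambda>s. s) p = 0" by (simp add: sum)
  moreover have "\<forall>m\<in>Poly_Mapping.keys p. Poly_Mapping.keys m \<subseteq> S"
    using keys_p keys_mon by blast
  ultimately have "p = 0" using S(2) by (simp add: algebraically_independent_def)
  then show "\<forall>f\<in>?F. c f = 0" using lookup_p by simp
qed

section \<open>Subrings with values in a cone: transcendence degree\<close>

text \<open>Isolates what the second claim takes from \<open>W\<close> and \<open>A\<close>. For
  \<open>A \<inter> O2\<close> the lower bound on \<open>\<nu>_bar\<close> comes from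
  \<open>O2\<close> and the upper one from the slope inequality.\<close>

locale cone_subring =
  fixes R :: "'k::field fls fls set" and D :: nat
  assumes subring: "is_subring R" and const: "range const2 \<subseteq> R"
    and cone: "\<And>x. x \<in> R \<Longrightarrow> x \<noteq> 0 \<Longrightarrow> \<nu> x \<le> 0 \<and> 0 \<le> \<nu>_bar x \<and> \<nu>_bar x \<le> int D * - \<nu> x"
begin

abbreviation filt :: "nat \<Rightarrow> 'k fls fls set" where
  "filt n \<equiv> R \<inter> pole_le n"

lemma subspace_filt: "V.subspace (filt n)"
  unfolding V.subspace_def
proof (intro conjI ballI allI)
  show "0 \<in> filt n" using subring by (simp add: is_subring_def pole_le_iff)
  show "x + y \<in> filt n" if "x \<in> filt n" "y \<in> filt n" for x y
    using that subring by (simp add: is_subring_def pole_le_def)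
  show "V_scale c x \<in> filt n" if "x \<in> filt n" for c x
    using that subring subsetD[OF const rangeI, of c] pole_le_mult[OF pole_le_const2, of x n c]
    by (simp add: is_subring_def)
qed

lemma filt_mult: "x \<in> filt m \<Longrightarrow> y \<in> filt n \<Longrightarrow> x * y \<in> filt (m + n)"
  using subring pole_le_mult by (auto simp: is_subring_def)

lemma filt_mono: "m \<le> n \<Longrightarrow> filt m \<subseteq> filt n"
  using pole_le_mono by blast

lemma filt_power: "x \<in> filt m \<Longrightarrow> x ^ n \<in> filt (n * m)"
  using subring is_subring_power pole_le_power by blast

lemma filt_prod: "(\<And>i. i \<in> I \<Longrightarrow> f i \<in> filt n) \<Longrightarrow> prod f I \<in> filt (card I * n)"
  using is_subring_prod[OF subring, of I f] pole_le_prod[of I f n] by blast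

text \<open>The cone cut off at pole order \<open>n\<close> fits into a rectangle with sides
  \<open>n\<close> and \<open>D * n\<close>, so the number of values grows at most
  quadratically.\<close>

lemma values_in_cone:
  "\<exists>T. finite T \<and> value_set (filt n) \<subseteq> T \<and> card T \<le> (n + 1) * (D * n + 1)"
proof (intro exI conjI)
  let ?T = "(\<lambda>(i, l). (- int i, int l)) ` ({..n} \<times> {..D * n})"
  show "value_set (filt n) \<subseteq> ?T"
  proof
    fix p assume "p \<in> value_set (filt n)"
    then obtain x where x: "x \<in> R" "x \<in> pole_le n" "x \<noteq> 0" "p = (\<nu> x, \<nu>_bar x)"
      by (auto simp: value_set_def)
    have b: "\<nu> x \<le> 0" "0 \<le> \<nu>_bar x" "\<nu>_bar x \<le> int D * - \<nu> x" using cone x by auto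
    have "int D * - \<nu> x \<le> int D * int n" using x(2,3) by (intro mult_left_mono) (auto simp: pole_le_iff)
    then have "nat (\<nu>_bar x) \<le> D * n" using b by (simp add: nat_le_iff)
    moreover have "nat (- \<nu> x) \<le> n" using x(2,3) by (auto simp: pole_le_iff)
    ultimately show "p \<in> ?T"
      using b(1,2) x(4) by (intro image_eqI[of _ _ "(nat (- \<nu> x), nat (\<nu>_bar x))"]) auto
  qed
  have "card ?T \<le> card ({..n} \<times> {..D * n})" by (intro card_image_le) auto
  then show "card ?T \<le> (n + 1) * (D * n + 1)" by simp
qed auto

text \<open>
  If \<open>d\<close> is a common denominator of \<open>X\<close>, multiplying the monomials with exponents below \<open>N\<close> in the
  three elements of \<open>X\<close> by \<open>d ^ (3 * N)\<close> gives \<open>N ^ 3\<close> elements of \<open>R\<close> with pole order \<open>O(N)\<close>.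
\<close>

lemma card_algebraically_independent_le_2:
  assumes S: "S \<subseteq> Frac R" "finite S" "algebraically_independent const2 S"
  shows "card S \<le> 2"
proof (rule ccontr)
  assume "\<not> card S \<le> 2"
  then obtain X where X: "X \<subseteq> S" "card X = 3"
    using obtain_subset_with_card_n[of 3 S] by auto
  then have fin: "finite X" and sub: "X \<subseteq> Frac R" using S finite_subset by auto
  have ai: "algebraically_independent const2 X"
    using S(3) X(1) unfolding algebraically_independent_def by (meson order_trans)
  obtain d where d: "d \<in> R" "d \<noteq> 0" "\<And>s. s \<in> X \<Longrightarrow> s * d \<in> R"
    using common_denominator[OF subring fin sub] by auto
  obtain m where "insert d ((\<lambda>s. s * d) ` X) \<subseteq> pole_le m"
    using finite_subset_pole_le[of "insert d ((\<lambda>s. s * d) ` X)"] fin by auto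
  then have m: "d \<in> filt m" "\<And>s. s \<in> X \<Longrightarrow> s * d \<in> filt m" using d by auto
  \<comment> \<open>With \<open>n\<close> linear in \<open>N\<close>, the number of values is at
    most N^2 times the product here; the added 1 makes N^3 strictly larger.\<close>
  define N where "N = (3 * m + 1) * (D * (3 * m) + 1) + 1"
  define n where "n = 3 * (N * m)"
  let ?F = "X \<rightarrow>\<^sub>E {..<N}"
  let ?e = "\<lambda>f. d ^ (3 * N) * (\<Prod>s\<in>X. s ^ f s)"
  have "?e f \<in> filt n" if f: "f \<in> ?F" for f
  proof -
    \<comment> \<open>Each of the three elements receives its own \<open>d ^ N\<close>, enough to
      clear the denominator of \<open>s ^ f s\<close> because \<open>f s < N\<close>.\<close>
    have "d ^ (3 * N) = (\<Prod>s\<in>X. d ^ N)" using X(2) by (simp add: mult.commute flip: power_mult)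
    then have "?e f = (\<Prod>s\<in>X. d ^ N * s ^ f s)" by (simp add: prod.distrib)
    also have "\<dots> = (\<Prod>s\<in>X. d ^ (N - f s) * (s * d) ^ f s)"
    proof (intro prod.cong refl)
      fix s assume "s \<in> X"
      then have "f s \<le> N" using f by (auto simp: PiE_iff less_imp_le)
      then have "d ^ N = d ^ (N - f s) * d ^ f s" by (simp flip: power_add)
      then show "d ^ N * s ^ f s = d ^ (N - f s) * (s * d) ^ f s" by (simp add: power_mult_distrib)
    qed
    also have "\<dots> \<in> filt (card X * (N * m))"
    proof (intro filt_prod)
      fix s assume s: "s \<in> X"
      then have "f s \<le> N" using f by (auto simp: PiE_iff less_imp_le)
      then have "(N - f s) * m + f s * m = N * m" by (simp flip: add_mult_distrib)
      then show "d ^ (N - f s) * (s * d) ^ f s \<in> filt (N * m)"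
        using filt_mult[OF filt_power[OF m(1)] filt_power[OF m(2)[OF s]], of "N - f s" "f s"] by simp
    qed
    finally show ?thesis by (simp add: n_def X(2))
  qed
  moreover have "lin_indep ?e ?F"
    unfolding lin_indep_def
  proof (intro allI impI)
    fix c assume "(\<Sum>f\<in>?F. V_scale (c f) (?e f)) = 0"
    also have "(\<Sum>f\<in>?F. V_scale (c f) (?e f)) = d ^ (3 * N) * (\<Sum>f\<in>?F. V_scale (c f) (\<Prod>s\<in>X. s ^ f s))"
      by (simp add: sum_distrib_left mult.left_commute)
    finally show "\<forall>f\<in>?F. c f = 0"
      using d(2) lin_indep_monomials[OF fin ai, of N] by (simp add: lin_indep_def)
  qed
  moreover have "finite ?F" using fin by (intro finite_PiE) auto
  moreover obtain T where T: "finite T" "value_set (filt n) \<subseteq> T" "card T \<le> (n + 1) * (D * n + 1)"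
    using values_in_cone by blast
  ultimately have "card ?F \<le> card T"
    by (intro card_lin_indep_le[OF subspace_filt, of _ _ ?e n]) auto
  also have "\<dots> \<le> (n + 1) * (D * n + 1)" by (rule T(3))
  also have "\<dots> \<le> (N * (3 * m + 1)) * (N * (D * (3 * m) + 1))"
    by (intro mult_mono) (auto simp: n_def N_def algebra_simps)
  also have "\<dots> = N * N * ((3 * m + 1) * (D * (3 * m) + 1))" by (simp add: algebra_simps)
  also have "\<dots> < N * N * N" by (intro mult_strict_left_mono) (auto simp: N_def)
  also have "\<dots> = card ?F" using fin X(2) by (simp add: card_PiE power3_eq_cube)
  finally show False by simp
qed

section \<open>Finite generation of the field of fractions\<close>

text \<open>If finite generation failed, one could choose \<open>r\<close> elements of
  \<open>R\<close>, each outside the field generated by the constants, \<open>Y\<close> and its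
  predecessors. Their products with the \<open>E i\<close> would be \<open>card I * r\<close>
  independent elements of \<open>filt (m + m')\<close>, too many for its values. Here
  \<open>m'\<close> bounds the poles of the chosen elements, so \<open>r\<close> must be fixed
  before \<open>m'\<close>, while \<open>I\<close>, \<open>E\<close> and \<open>m\<close> may depend
  on it.\<close>

lemma finitely_generated_if_growth:
  assumes Y: "finite Y" "Y \<subseteq> R"
    and growth: "\<And>m'. \<exists>I E m T. finite I \<and> E ` I \<subseteq> filt m \<inter> is_subfield hull (range const2 \<union> Y) \<and>
      lin_indep E I \<and> finite T \<and> value_set (filt (m + m')) \<subseteq> T \<and> card T < card (I :: (nat \<times> nat) set) * r"
  shows "finitely_generated_field const2 (Frac R)"
proof (rule ccontr)
  assume not_fg: "\<not> ?thesis"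
  define F where "F g j = is_subfield hull (range const2 \<union> (Y \<union> g ` {..<j}))"
    for g :: "nat \<Rightarrow> 'k fls fls" and j :: nat
  have "\<exists>g. \<forall>j<n. g j \<in> R \<and> g j \<notin> F g j" for n
  proof (induction n)
    case (Suc n)
    then obtain g where g: "\<And>j. j < n \<Longrightarrow> g j \<in> R \<and> g j \<notin> F g j" by blast
    have "\<not> R \<subseteq> F g n"
      using not_fg finitely_generated_Frac[OF subring const, of "Y \<union> g ` {..<n}"] Y g
      by (auto simp: F_def)
    then obtain x where x: "x \<in> R" "x \<notin> F g n" by blast
    have "F (g(n := x)) j = F g j" if "j \<le> n" for j
    proof -
      have "g(n := x) ` {..<j} = g ` {..<j}" using that by (intro image_cong) auto
      then show ?thesis by (simp add: F_def)
    qed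
    then show ?case using g x by (intro exI[of _ "g(n := x)"]) (auto simp: less_Suc_eq simp del: fun_upd_apply, simp_all)
  qed simp
  then obtain g where g: "\<And>j. j < r \<Longrightarrow> g j \<in> R" "\<And>j. j < r \<Longrightarrow> g j \<notin> F g j" by metis
  obtain m' where m': "g ` {..<r} \<subseteq> pole_le m'" using finite_subset_pole_le[of "g ` {..<r}"] by auto
  obtain I :: "(nat \<times> nat) set" and E m T where
    E: "finite I" "E ` I \<subseteq> filt m" "E ` I \<subseteq> F g 0" "lin_indep E I"
    and T: "finite T" "value_set (filt (m + m')) \<subseteq> T" "card T < card I * r"
    using growth[of m'] by (auto simp: F_def)
  have "lin_indep (\<lambda>(i, j). E i * g j) (I \<times> {..<r})"
  proof (rule lin_indep_field_extension[where F = "F g"])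
    show "F g i \<subseteq> F g j" if "i \<le> j" for i j
      unfolding F_def using that by (intro hull_mono) auto
    show "range const2 \<subseteq> F g 0" by (auto simp: F_def intro: hull_inc)
    show "g i \<in> F g j" if "i < j" "j < r" for i j
      using that by (auto simp: F_def intro!: hull_inc)
  qed (use g E in \<open>auto simp: F_def is_subfield_hull\<close>)
  moreover have "(case p of (i, j) \<Rightarrow> E i * g j) \<in> filt (m + m')" if "p \<in> I \<times> {..<r}" for p
  proof -
    obtain i j where p: "p = (i, j)" "i \<in> I" "j < r" using \<open>p \<in> _\<close> by auto
    have "E i \<in> filt m" "g j \<in> filt m'" using p E(2) g(1) m' by auto
    from filt_mult[OF this] show ?thesis by (simp add: p(1))
  qed
  ultimately have "card (I \<times> {..<r}) \<le> card T"
    using E(1) T by (intro card_lin_indep_le[OF subspace_filt]) auto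
  then show False using T(3) by (simp add: card_cartesian_product)
qed

text \<open>The cases are the rational rank of the values of \<open>R\<close>. In rank 1 a
  \<open>y\<close> with \<open>\<nu> y \<noteq> 0\<close> exists, because in the cone
  \<open>\<nu> y = 0\<close> forces \<open>\<nu>_bar y = 0\<close>. In each rank the monomials in
  \<open>Y\<close> and the values of \<open>filt n\<close> grow at the same rate, so a constant
  factor \<open>r\<close> decides.\<close>

lemma finitely_generated_Frac_cone: "finitely_generated_field const2 (Frac R)"
proof -
  consider (rank2) x y where "x \<in> R" "y \<in> R" "x \<noteq> 0" "y \<noteq> 0" "\<nu> x * \<nu>_bar y \<noteq> \<nu> y * \<nu>_bar x"
    | (rank1) y where "y \<in> R" "y \<noteq> 0" "\<nu> y \<noteq> 0"
        "\<And>x. x \<in> R \<Longrightarrow> x \<noteq> 0 \<Longrightarrow> \<nu> x * \<nu>_bar y = \<nu> y * \<nu>_bar x"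
    | (rank0) "\<And>y. y \<in> R \<Longrightarrow> y \<noteq> 0 \<Longrightarrow> \<nu> y = 0"
    by metis
  then show ?thesis
  proof cases
    case rank2
    obtain k where k: "{x, y} \<subseteq> pole_le k" using finite_subset_pole_le[of "{x, y}"] by auto
    \<comment> \<open>The choice \<open>N = m' + 1\<close> below gives
      \<open>n + 1 = N * (2 * k + 1)\<close>. Hence the number of values is less than
      \<open>N * N * r\<close>, with \<open>r\<close> depending on \<open>k\<close> and
      \<open>D\<close> alone.\<close>
    define r where "r = (2 * k + 1) * (D * (2 * k + 1) + 1) + 1"
    let ?hull = "is_subfield hull (range const2 \<union> {x, y})"
    show ?thesis
    proof (rule finitely_generated_if_growth[where Y = "{x, y}" and r = r])
      fix m' :: nat
      define N where "N = m' + 1"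
      define n where "n = 2 * (N * k) + m'"
      obtain T where T: "finite T" "value_set (filt n) \<subseteq> T" "card T \<le> (n + 1) * (D * n + 1)"
        using values_in_cone by blast
      define I where "I = {..<N} \<times> {..<N}"
      define E where "E = (\<lambda>(i, j). x ^ i * y ^ j)"
      have "E p \<in> filt (2 * (N * k))" if "p \<in> I" for p
      proof -
        obtain i j where p: "p = (i, j)" by fastforce
        then have ij: "i \<le> N" "j \<le> N" using that by (auto simp: I_def)
        have "E p \<in> filt (i * k + j * k)"
          using filt_mult[OF filt_power[of x k i] filt_power[of y k j]] rank2 k by (simp add: E_def p)
        moreover have "i * k + j * k \<le> 2 * (N * k)"
          using mult_le_mono1[OF ij(1), of k] mult_le_mono1[OF ij(2), of k] by linarith
        ultimately show ?thesis using filt_mono by blast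
      qed
      moreover have "E p \<in> ?hull" for p
      proof -
        have "x \<in> ?hull" "y \<in> ?hull" by (auto intro: hull_inc)
        then show ?thesis using is_subring_hull[of "range const2 \<union> {x, y}"]
            is_subring_power[OF is_subring_hull, of _ "range const2 \<union> {x, y}"]
          by (auto simp: E_def is_subring_def split: prod.split)
      qed
      moreover have "lin_indep E I"
      proof (rule lin_indep_if_distinct_values)
        show "E p \<noteq> 0" for p using rank2 by (auto simp: E_def split: prod.split)
        show "inj_on (\<lambda>p. (\<nu> (E p), \<nu>_bar (E p))) I"
        proof (rule inj_onI, clarify)
          fix i j i' j'
          assume "\<nu> (E (i, j)) = \<nu> (E (i', j'))" "\<nu>_bar (E (i, j)) = \<nu>_bar (E (i', j'))"
          then have "(int i - int i') * \<nu> x + (int j - int j') * \<nu> y = 0"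
            "(int i - int i') * \<nu>_bar x + (int j - int j') * \<nu>_bar y = 0"
            using rank2 by (simp_all add: E_def \<nu>_mult \<nu>_bar_mult \<nu>_power \<nu>_bar_power algebra_simps)
          \<comment> \<open>Cramer's rule: the factor is the determinant of the two values, which is
            nonzero in this case.\<close>
          then have "(int i - int i') * (\<nu> x * \<nu>_bar y - \<nu> y * \<nu>_bar x) = 0"
            "(int j - int j') * (\<nu> x * \<nu>_bar y - \<nu> y * \<nu>_bar x) = 0" by algebra+
          then show "i = i' \<and> j = j'" using rank2 by simp
        qed
      qed (simp add: I_def)
      moreover have "card T < card I * r"
      proof -
        have "card T \<le> (n + 1) * (D * n + 1)" by (rule T(3))
        also have "\<dots> \<le> (N * (2 * k + 1)) * (N * (D * (2 * k + 1) + 1))"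
          by (intro mult_mono) (auto simp: n_def N_def algebra_simps)
        also have "\<dots> = N * N * ((2 * k + 1) * (D * (2 * k + 1) + 1))" by (simp only: ac_simps)
        also have "\<dots> < N * N * r" by (intro mult_strict_left_mono) (auto simp: r_def N_def)
        also have "\<dots> = card I * r" by (simp add: I_def)
        finally show ?thesis .
      qed
      ultimately show "\<exists>I E m T. finite I \<and> E ` I \<subseteq> filt m \<inter> ?hull \<and> lin_indep E I \<and> finite T \<and>
          value_set (filt (m + m')) \<subseteq> T \<and> card T < card (I :: (nat \<times> nat) set) * r"
        using T(1,2) unfolding n_def
        by (intro exI[of _ I] exI[of _ E] exI[of _ "2 * (N * k)"] exI[of _ T]) (auto simp: I_def)
    qed (use rank2 in auto)
  next
    case rank1
    obtain k where k: "{y} \<subseteq> pole_le k" using finite_subset_pole_le[of "{y}"] by auto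
    let ?hull = "is_subfield hull (range const2 \<union> {y})"
    show ?thesis
    \<comment> \<open>There will be at most \<open>n + 1 = N * (k + 1)\<close> values against
      \<open>N\<close> powers of \<open>y\<close>, so \<open>k + 2\<close> is a sufficient
      factor.\<close>
    proof (rule finitely_generated_if_growth[where Y = "{y}" and r = "k + 2"])
      fix m' :: nat
      define N where "N = m' + 1"
      define n where "n = N * k + m'"
      \<comment> \<open>All values are proportional to that of \<open>y\<close>, so
        \<open>\<nu>\<close> determines \<open>\<nu>_bar\<close> and the count is linear in
        \<open>n\<close>. The division is exact whenever \<open>- int i\<close> is a value of
        \<open>\<nu>\<close> on nonzero elements of \<open>R\<close>.\<close>
      define T where "T = (\<lambda>i. (- int i, (int i * \<nu>_bar y) div (- \<nu> y))) ` {..n}"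
      define I where "I = {..<N} \<times> {0::nat}"
      define E where "E = (\<lambda>(i, j::nat). y ^ i)"
      have "E p \<in> filt (N * k)" if "p \<in> I" for p
      proof -
        have "fst p * k \<le> N * k" using that by (auto simp: I_def)
        moreover have "E p \<in> filt (fst p * k)" using filt_power rank1 k by (auto simp: E_def split: prod.split)
        ultimately show ?thesis using filt_mono by blast
      qed
      moreover have "E p \<in> ?hull" for p
      proof -
        have "y \<in> ?hull" by (auto intro: hull_inc)
        moreover have "E p = y ^ fst p" by (simp add: E_def split: prod.split)
        ultimately show ?thesis using is_subring_power[OF is_subring_hull, of y _ "fst p"] by metis
      qed
      moreover have "lin_indep E I"
      proof (rule lin_indep_if_distinct_values)
        show "E p \<noteq> 0" for p using rank1 by (auto simp: E_def split: prod.split)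
        show "inj_on (\<lambda>p. (\<nu> (E p), \<nu>_bar (E p))) I"
          using rank1 by (auto simp: inj_on_def E_def I_def \<nu>_power)
      qed (simp add: I_def)
      moreover have "value_set (filt n) \<subseteq> T"
      proof
        fix p assume "p \<in> value_set (filt n)"
        then obtain x where x: "x \<in> R" "x \<in> pole_le n" "x \<noteq> 0" "p = (\<nu> x, \<nu>_bar x)"
          by (auto simp: value_set_def)
        have neg: "\<nu> x \<le> 0" using cone x by blast
        have "- \<nu> x * \<nu>_bar y = \<nu>_bar x * - \<nu> y" using rank1(4)[OF x(1,3)] by simp
        then have "(- \<nu> x * \<nu>_bar y) div (- \<nu> y) = \<nu>_bar x"
          using rank1(3) by (metis neg_equal_0_iff_equal nonzero_mult_div_cancel_right)
        then show "p \<in> T" unfolding T_def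
          using x neg by (intro image_eqI[of _ _ "nat (- \<nu> x)"]) (auto simp: pole_le_iff)
      qed
      moreover have "card T < card I * (k + 2)"
      proof -
        have "card T \<le> n + 1" unfolding T_def using card_image_le[of "{..n}"] by simp
        then show ?thesis by (simp add: n_def N_def I_def)
      qed
      ultimately show "\<exists>I E m T. finite I \<and> E ` I \<subseteq> filt m \<inter> ?hull \<and> lin_indep E I \<and> finite T \<and>
          value_set (filt (m + m')) \<subseteq> T \<and> card T < card (I :: (nat \<times> nat) set) * (k + 2)"
        unfolding n_def
        by (intro exI[of _ I] exI[of _ E] exI[of _ "N * k"] exI[of _ T]) (auto simp: I_def T_def)
    qed (use rank1 in auto)
  next
    case rank0
    \<comment> \<open>The cone leaves \<open>(0, 0)\<close> as the only value, so the constant 1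
      alone with \<open>r = 2\<close> already exceeds the count.\<close>
    let ?I = "{(0, 0)} :: (nat \<times> nat) set" and ?E = "\<lambda>_. 1 :: 'k fls fls"
    have "1 \<in> filt 0" "1 \<in> is_subfield hull (range const2)"
      using filt_power[of 0 0 0] subring is_subring_hull by (auto simp: is_subring_def pole_le_def)
    moreover have "lin_indep ?E ?I" by (simp add: lin_indep_def const2_def)
    moreover have "value_set (filt n) \<subseteq> {(0, 0)}" for n
      using rank0 cone by (fastforce simp: value_set_def)
    ultimately show ?thesis
      by (intro finitely_generated_if_growth[where Y = "{}" and r = 2] allI
          exI[of _ ?I] exI[of _ ?E] exI[of _ 0] exI[of _ "{(0, 0)}"]) auto
  qed
qed

end


section \<open>Application to \<open>A \<inter> O2\<close>\<close>

lemma is_subring_O2: "is_subring (O2 :: 'k::field fls fls set)"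
proof -
  have ps: "0 \<in> (power_series :: 'k fls set)"
    "\<And>x y :: 'k fls. x \<in> power_series \<Longrightarrow> y \<in> power_series \<Longrightarrow> x * y \<in> power_series"
    using fls_times_fps_to_fls by (force simp: power_series_def simp flip: fls_times_fps_to_fls)+
  have "x * y \<in> O2" if "x \<in> O2" "y \<in> O2" for x y :: "'k fls fls"
    using that ps by (auto simp: O2_def fls_times_nth(2) intro!: kt.subspace_sum subspace_power_series)
  then show ?thesis
    by (auto simp: is_subring_def O2_def power_series_iff)
qed

theorem theorem1:
  fixes W A :: "'k::field fls fls set" and a b :: real
  assumes "V.subspace W"
    and "\<And>n. fredholm (graded_piece W n)"
    and "b < 0"
    and "\<And>n. of_int (euler_char (graded_piece W n)) = a + b * of_int n"
    and "is_subring A"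
    and "range const2 \<subseteq> A"
    and "A * W \<subseteq> W"
  shows "(\<forall>x\<in>A. x \<noteq> 0 \<longrightarrow> of_int (\<nu>_bar x) \<le> b * of_int (\<nu> x)) \<and>
         trdeg const2 (Frac (A \<inter> O2)) \<le> 2 \<and>
         finitely_generated_field const2 (Frac (A \<inter> O2))"
proof -
  have slope: "of_int (\<nu>_bar x) \<le> b * of_int (\<nu> x)" if "x \<in> A" "x \<noteq> 0" for x
  proof -
    have "x * w \<in> W" if "w \<in> W" for w using assms(7) \<open>x \<in> A\<close> that by (auto intro: subsetD)
    then have "fls_nth x (\<nu> x) * y \<in> graded_piece W (0 + \<nu> x)" if "y \<in> graded_piece W 0" for y
      using graded_piece_mult \<open>x \<noteq> 0\<close> that by blast
    \<comment> \<open>Comparing the pieces at 0 and at \<open>\<nu> x\<close> makes \<open>a\<close>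
      cancel and leaves exactly \<open>b\<close> times \<open>\<nu> x\<close> on the right.\<close>
    then have "euler_char (graded_piece W 0) + \<nu>_bar x \<le> euler_char (graded_piece W (\<nu> x))"
      unfolding \<nu>_bar_def using \<open>x \<noteq> 0\<close>
      by (intro euler_char_shift_le assms(2)) (auto simp: \<nu>_def)
    then have "real_of_int (euler_char (graded_piece W 0)) + of_int (\<nu>_bar x) \<le>
        of_int (euler_char (graded_piece W (\<nu> x)))"
      by linarith
    then show ?thesis unfolding assms(4) by simp
  qed
  \<comment> \<open>The positive slope \<open>- b\<close> is rounded up to a natural number. This
    preserves the upper bound because \<open>\<nu> x \<le> 0\<close>, which itself follows from
    \<open>0 \<le> \<nu>_bar x\<close>, the slope inequality and \<open>b < 0\<close>.\<close>
  interpret cone_subring "A \<inter> O2" "nat \<lceil>- b\<rceil>"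
  proof
    show "is_subring (A \<inter> O2)" using assms(5) is_subring_O2 by (auto simp: is_subring_def)
    have "const2 c \<in> O2" for c :: 'k by (auto simp: O2_def const2_def power_series_iff)
    then show "range const2 \<subseteq> A \<inter> O2" using assms(6) by auto
    fix x assume x: "x \<in> A \<inter> O2" "x \<noteq> 0"
    have "fls_nth x (\<nu> x) \<in> power_series" using x(1) by (simp add: O2_def)
    then have bar: "0 \<le> \<nu>_bar x"
      unfolding \<nu>_bar_def power_series_iff by (intro fls_subdegree_ge0I) auto
    have le: "of_int (\<nu>_bar x) \<le> b * of_int (\<nu> x)" using slope x by auto
    with bar have "0 \<le> b * of_int (\<nu> x)" by linarith
    then have nonpos: "\<nu> x \<le> 0" using assms(3) by (simp add: zero_le_mult_iff)
    have "b * of_int (\<nu> x) = - b * of_int (- \<nu> x)" by simp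
    also have "\<dots> \<le> of_int (int (nat \<lceil>- b\<rceil>)) * of_int (- \<nu> x)"
      using assms(3) nonpos by (intro mult_right_mono) (auto simp: of_nat_ceiling)
    finally have "real_of_int (\<nu>_bar x) \<le> real_of_int (int (nat \<lceil>- b\<rceil>) * - \<nu> x)" using le by simp
    then have "\<nu>_bar x \<le> int (nat \<lceil>- b\<rceil>) * - \<nu> x" by linarith
    with bar nonpos show "\<nu> x \<le> 0 \<and> 0 \<le> \<nu>_bar x \<and> \<nu>_bar x \<le> int (nat \<lceil>- b\<rceil>) * - \<nu> x" by blast
  qed
  have "trdeg const2 (Frac (A \<inter> O2)) \<le> enat 2"
    unfolding trdeg_def using card_algebraically_independent_le_2 by (intro SUP_least) auto
  then show ?thesis using slope finitely_generated_Frac_cone by (simp add: numeral_eq_enat)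
qed

end
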